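(* Let $S$ be a locally convex topological semilattice. Then every nonempty compact subset of $S$ has at least one extreme point, and every compact convex subset $K$ of $S$ is the closed convex hull of its extreme points, i.e. $K=\overline{\operatorname{co}}(\operatorname{ex}K)$.
   Context: A semilattice is a poset $S$ in which every nonempty finite subset $F$ has a supremum $\bigoplus F$; write $x\oplus y=\bigoplus\{x,y\}$. A subset $T\subset S$ is convex if it is a subsemilattice: $x\oplus y\in T$ for all $x,y\in T$ (the empty set is convex). The convex hull $\operatorname{co}(A)$ is the subsemilattice generated by $A$, and $\overline{\operatorname{co}}(A)$ is its topological closure. A point $x\in A$ is an extreme point of $A\subset S$ if $x\notin\operatorname{co}(A\setminus\{x\})$; $\operatorname{ex}A$ is the set of extreme points of $A$. A topological semilattice is a semilattice with a Hausdorff topology for which $\oplus:S\times S\to S$ is jointly continuous. It is locally convex if every point has a basis of (not necessarily open) convex neighbourhoods. *)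

theory Defs
  imports "HOL-Analysis.Elementary_Topology"
begin

context semilattice_sup
begin

definition sl_convex :: "'a set \<Rightarrow> bool"
  where "sl_convex T \<longleftrightarrow> (\<forall>x\<in>T. \<forall>y\<in>T. sup x y \<in> T)"

definition sl_co :: "'a set \<Rightarrow> 'a set"
  where "sl_co A = sl_convex hull A"

definition sl_extreme :: "'a set \<Rightarrow> 'a set"
  where "sl_extreme A = {x \<in> A. x \<notin> sl_co (A - {x})}"

end

text \<open>
  Joint continuity is phrased with a product filter, as for
  \<^class>\<open>topological_monoid_add\<close>, because the product topology cannot be used
  inside a class specification; see \<open>continuous_on_sup_Pair_iff\<close> below.
\<close>

class topological_semilattice_sup = semilattice_sup + t2_space +
  assumes tendsto_sup_Pair:
    "LIM p (nhds a \<times>\<^sub>F nhds b). sup (fst p) (snd p) :> nhds (sup a b)"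

lemma continuous_on_sup_Pair_iff:
  "continuous_on UNIV (\<lambda>p::'a::{semilattice_sup, topological_space} \<times> 'a. sup (fst p) (snd p)) \<longleftrightarrow>
    (\<forall>a b::'a. LIM p (nhds a \<times>\<^sub>F nhds b). sup (fst p) (snd p) :> nhds (sup a b))"
proof -
  let ?f = "\<lambda>p::'a \<times> 'a. sup (fst p) (snd p)"
  have "continuous_on UNIV ?f \<longleftrightarrow> (\<forall>p. (?f \<longlongrightarrow> ?f p) (nhds p))"
    using tendsto_at_iff_tendsto_nhds[of ?f] by (simp add: continuous_on_def)
  then show ?thesis
    by (simp add: nhds_prod split_paired_all)
qed

class locally_convex_semilattice_sup = topological_semilattice_sup +
  assumes locally_convex:
    "open U \<Longrightarrow> x \<in> U \<Longrightarrow>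
      \<exists>V C. open V \<and> x \<in> V \<and> V \<subseteq> C \<and> C \<subseteq> U \<and> sl_convex C"

end

theory Submission
  imports Defs "HOL-Analysis.T1_Spaces"
begin

text \<open>
  The argument is order-theoretic.  A point \<open>e\<close> of \<open>A\<close> is extreme as soon as all points of \<open>A\<close>
  strictly below \<open>e\<close> lie in some subsemilattice that misses \<open>e\<close>
  (\<open>sl_extremeI\<close>).  With the empty subsemilattice this makes every minimal element extreme, and a
  nonempty compact set has minimal elements because the order is closed
  (\<open>compact_has_minimal\<close>).  This is the first claim.

  For the second claim let \<open>x \<in> K\<close> and let \<open>E\<close> be the set of extreme points of \<open>K\<close> below \<open>x\<close>.
  The closed convex hull of \<open>E\<close> is compact, convex and nonempty, hence has a greatest
  element \<open>y \<le> x\<close> (\<open>compact_sl_convex_has_greatest\<close>).  It is enough to see that \<open>x \<le> y\<close>, for then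
  \<open>x = y\<close> is in the closed hull.  If not, there is an ideal of \<open>K\<close> (a lower subsemilattice),
  open in \<open>K\<close>, that contains \<open>y\<close> but not \<open>x\<close>, and a minimal element \<open>e\<close> of the compact
  set of those points of \<open>K\<close> that are below \<open>x\<close> and outside the ideal is an extreme point of
  \<open>K\<close>.  So \<open>e \<in> E\<close> and \<open>e \<le> y\<close>, which puts \<open>e\<close> into the ideal: a contradiction
  (\<open>sl_extreme_separates\<close>).

  Local convexity is what produces the open ideal.  A closed convex neighbourhood of \<open>y\<close> in \<open>K\<close>
  has a greatest element \<open>d\<close>, so that the principal ideal of \<open>d\<close> is a neighbourhood of \<open>y\<close>; and
  the neighbourhood can be chosen so small that \<open>x \<le> d\<close> fails (\<open>upper_bound_of_nhd\<close>).
  Iterating this step and taking the union of the principal ideals yields an open one.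
  In the language of continuous lattices, with the order reversed, this is the construction of a
  Scott-open filter by interpolation of the way-below relation, and the result is the theorem that
  irreducible elements are order generating.
\<close>

section \<open>Closed order and compactness\<close>

lemma continuous_on_sup_left:
  fixes c :: "'a::topological_semilattice_sup"
  shows "continuous_on UNIV (\<lambda>z. sup z c)"
proof -
  have "((\<lambda>z. sup z c) \<longlongrightarrow> sup z c) (nhds z)" for z
  proof -
    have "filterlim (\<lambda>z. (z, c)) (nhds z \<times>\<^sub>F nhds c) (nhds z)"
      by (intro filterlim_Pair filterlim_ident tendsto_const)
    from filterlim_compose[OF tendsto_sup_Pair this] show ?thesis by simp
  qed
  then show ?thesis
    by (auto simp: continuous_on_def tendsto_at_iff_tendsto_nhds[of "\<lambda>z. sup z c"])
qed

lemma closed_sl_atLeast: "closed {a :: 'a::topological_semilattice_sup ..}"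
proof -
  have "{a..} = {z. sup z a = z}"
    by (auto simp: sup.absorb_iff1)
  then show ?thesis
    by (simp add: closed_Collect_eq continuous_on_sup_left)
qed

lemma closed_sl_atMost: "closed {..a :: 'a::topological_semilattice_sup}"
proof -
  have "{..a} = {z. sup z a = a}"
    by (auto simp: sup.absorb_iff2)
  then show ?thesis
    by (simp add: closed_Collect_eq continuous_on_sup_left)
qed

text \<open>Zorn's lemma: the principal ideals of a chain have the finite intersection property, and a
  common point of them is a lower bound of the chain.\<close>

lemma compact_has_minimal:
  fixes A :: "'a::topological_semilattice_sup set"
  assumes "compact A" "A \<noteq> {}"
  obtains m where "m \<in> A" "\<And>a. a \<in> A \<Longrightarrow> a \<le> m \<Longrightarrow> a = m"
proof -
  have "\<exists>m\<in>A. \<forall>a\<in>A. m \<ge> a \<longrightarrow> a = m"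
  proof (rule predicate_Zorn)
    show "partial_order_on A (relation_of (\<ge>) A)"
      by (rule partial_order_on_relation_ofI) auto
  next
    fix C assume "C \<in> Chains (relation_of (\<ge>) A)"
    then have CA: "C \<subseteq> A" and chain: "\<And>a b. a \<in> C \<Longrightarrow> b \<in> C \<Longrightarrow> a \<le> b \<or> b \<le> a"
      by (auto simp: Chains_def relation_of_def)
    have "A \<inter> \<Inter>(atMost ` C) \<noteq> {}"
    proof (rule compact_imp_fip[OF \<open>compact A\<close>])
      fix \<F> assume "finite \<F>" "\<F> \<subseteq> atMost ` C"
      then obtain F where F: "F \<subseteq> C" "finite F" "\<F> = atMost ` F"
        by (meson finite_subset_image)
      show "A \<inter> \<Inter>\<F> \<noteq> {}"
      proof (cases "F = {}")
        case True
        then show ?thesis using F \<open>A \<noteq> {}\<close> by simp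
      next
        case False
        then obtain m where m: "m \<in> F" "\<And>b. b \<in> F \<Longrightarrow> b \<le> m \<Longrightarrow> m = b"
          using finite_has_minimal[OF \<open>finite F\<close>] by blast
        have "m \<le> b" if "b \<in> F" for b
          using chain[of m b] m that F(1) by blast
        then have "m \<in> A \<inter> \<Inter>\<F>" using m(1) F CA by auto
          then show ?thesis by blast
      qed
    qed (auto simp: closed_sl_atMost)
    then show "\<exists>u\<in>A. \<forall>a\<in>C. a \<ge> u" by auto
  qed
  then show thesis using that by blast
qed

text \<open>The principal filters of the points of \<open>M\<close> have the finite intersection property in \<open>M\<close>,
  because finitely many points of a subsemilattice have an upper bound in it.\<close>

lemma compact_sl_convex_has_greatest:
  fixes M :: "'a::topological_semilattice_sup set"
  assumes "compact M" "sl_convex M" "M \<noteq> {}"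
  obtains t where "t \<in> M" "\<And>a. a \<in> M \<Longrightarrow> a \<le> t"
proof -
  have bound: "\<exists>u\<in>M. \<forall>a\<in>F. a \<le> u" if "finite F" "F \<subseteq> M" for F
    using that
  proof (induction F rule: finite_induct)
    case empty
    then show ?case using \<open>M \<noteq> {}\<close> by auto
  next
    case (insert b F)
    then obtain u where "u \<in> M" "\<forall>a\<in>F. a \<le> u" by auto
    moreover have "sup b u \<in> M"
      using insert.prems \<open>u \<in> M\<close> \<open>sl_convex M\<close> by (simp add: sl_convex_def)
    ultimately show ?case
      by (intro bexI[of _ "sup b u"]) (auto intro: le_supI2)
  qed
  have "M \<inter> \<Inter>(atLeast ` M) \<noteq> {}"
  proof (rule compact_imp_fip[OF \<open>compact M\<close>])
    fix \<F> assume "finite \<F>" "\<F> \<subseteq> atLeast ` M"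
    then obtain F where F: "F \<subseteq> M" "finite F" "\<F> = atLeast ` F"
      by (meson finite_subset_image)
    then show "M \<inter> \<Inter>\<F> \<noteq> {}"
      using bound[of F] by auto
  qed (auto simp: closed_sl_atLeast)
  then show thesis using that by auto
qed

section \<open>Convex hulls and extreme points\<close>

lemma sl_convex_sl_co: "sl_convex (sl_co A)"
  unfolding sl_co_def by (rule hull_in) (auto simp: sl_convex_def)

lemma sl_co_minimal: "A \<subseteq> T \<Longrightarrow> sl_convex T \<Longrightarrow> sl_co A \<subseteq> T"
  unfolding sl_co_def by (rule hull_minimal)

lemma subset_sl_co: "A \<subseteq> sl_co A"
  unfolding sl_co_def by (rule hull_subset)

lemma sl_convex_closure:
  fixes T :: "'a::topological_semilattice_sup set"
  assumes "sl_convex T"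
  shows "sl_convex (closure T)"
proof -
  have closed: "closed ((\<lambda>z. sup z c) -` closure T)" for c
    by (intro closed_vimage closed_closure continuous_on_sup_left)
  \<comment> \<open>The closure is taken in one argument at a time.\<close>
  have half: "sup a b \<in> closure T" if "a \<in> closure T" "b \<in> T" for a b
  proof -
    have "T \<subseteq> (\<lambda>z. sup z b) -` closure T"
      using assms that(2) by (auto simp: sl_convex_def intro!: subsetD[OF closure_subset])
    from closure_minimal[OF this closed] show ?thesis using that(1) by auto
  qed
  have "sup a b \<in> closure T" if "a \<in> closure T" "b \<in> closure T" for a b
  proof -
    have "T \<subseteq> (\<lambda>z. sup z b) -` closure T"
      using half[OF that(2)] by (auto simp: sup_commute)
    from closure_minimal[OF this closed] show ?thesis using that(1) by auto
  qed
  then show ?thesis by (simp add: sl_convex_def)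
qed

text \<open>The points \<open>z\<close> for which \<open>z \<le> e\<close> implies \<open>z \<in> I\<close> form a subsemilattice, since
  \<open>sup a b \<le> e\<close> forces both \<open>a \<le> e\<close> and \<open>b \<le> e\<close>.  It contains \<open>A - {e}\<close> but not \<open>e\<close>, so
  it keeps \<open>e\<close> out of the hull.\<close>

lemma sl_extremeI:
  assumes "e \<in> A" "sl_convex I" "e \<notin> I"
    and below: "\<And>a. a \<in> A \<Longrightarrow> a \<le> e \<Longrightarrow> a \<noteq> e \<Longrightarrow> a \<in> I"
  shows "e \<in> sl_extreme A"
proof -
  let ?T = "{z. z \<le> e \<longrightarrow> z \<in> I}"
  have "sl_convex ?T"
    using \<open>sl_convex I\<close> by (auto simp: sl_convex_def)
  then have "sl_co (A - {e}) \<subseteq> ?T"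
    using below by (intro sl_co_minimal) auto
  then show ?thesis
    using \<open>e \<in> A\<close> \<open>e \<notin> I\<close> by (auto simp: sl_extreme_def)
qed

lemma sl_extreme_below:
  fixes A :: "'a::topological_semilattice_sup set"
  assumes "compact A" "x \<in> A"
  obtains e where "e \<in> sl_extreme A" "e \<le> x"
proof -
  have "compact (A \<inter> {..x})" "A \<inter> {..x} \<noteq> {}"
    using assms by (auto intro: compact_Int_closed closed_sl_atMost)
  then obtain m where m: "m \<in> A \<inter> {..x}" "\<And>a. a \<in> A \<inter> {..x} \<Longrightarrow> a \<le> m \<Longrightarrow> a = m"
    by (rule compact_has_minimal) blast
  have "m \<in> sl_extreme A"
  proof (rule sl_extremeI[where I = "{}"])
    show "a \<in> {}" if "a \<in> A" "a \<le> m" "a \<noteq> m" for a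
      using m that order_trans[of a m x] by auto
  qed (use m in \<open>auto simp: sl_convex_def\<close>)
  then show thesis using that m(1) by auto
qed

section \<open>Separation by open ideals\<close>

text \<open>The points of \<open>K\<close> above \<open>x\<close> form a compact set that misses \<open>c\<close>, so a convex neighbourhood
  of \<open>c\<close> can be chosen whose closure misses it as well.  The greatest element of
  the closure of its trace on \<open>K\<close> is the bound.\<close>

lemma upper_bound_of_nhd:
  fixes K :: "'a::locally_convex_semilattice_sup set"
  assumes "compact K" "sl_convex K" "c \<in> K" "\<not> x \<le> c"
  obtains d V where "d \<in> K" "\<not> x \<le> d" "open V" "c \<in> V" "K \<inter> V \<subseteq> {..d}"
proof -
  have "compact (K \<inter> {x..})" "disjnt {c} (K \<inter> {x..})"
    using assms by (auto intro: compact_Int_closed closed_sl_atLeast simp: disjnt_def)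
  moreover have "Hausdorff_space (euclidean :: 'a topology)"
    by (simp add: Hausdorff_space_def disjnt_def separation_t2)
  ultimately obtain U W where UW: "open U" "open W" "c \<in> U" "K \<inter> {x..} \<subseteq> W" "U \<inter> W = {}"
    using Hausdorff_space_compact_separation[of euclidean "{c}" "K \<inter> {x..}"]
    by (auto simp: disjnt_def)
  then obtain V C where VC: "open V" "c \<in> V" "V \<subseteq> C" "C \<subseteq> U" "sl_convex C"
    using locally_convex by metis
  define M where "M = closure (K \<inter> C)"
  have "M \<subseteq> K"
    unfolding M_def using \<open>compact K\<close> by (intro closure_minimal) (auto intro: compact_imp_closed)
  moreover have "M \<subseteq> - W"
    unfolding M_def using UW VC by (intro closure_minimal) auto
  moreover have "sl_convex M"
    unfolding M_def using VC(5) \<open>sl_convex K\<close>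
    by (intro sl_convex_closure) (auto simp: sl_convex_def)
  moreover have "compact M"
    using compact_Int_closed[OF \<open>compact K\<close>, of M] \<open>M \<subseteq> K\<close>
    by (simp add: M_def Int_absorb1)
  moreover have sub: "K \<inter> V \<subseteq> M"
    unfolding M_def using VC(3) closure_subset by fast
  ultimately obtain d where "d \<in> M" "\<And>a. a \<in> M \<Longrightarrow> a \<le> d"
    using compact_sl_convex_has_greatest[of M] VC(2) \<open>c \<in> K\<close> by blast
  then have "d \<in> K" "\<not> x \<le> d" "K \<inter> V \<subseteq> {..d}"
    using \<open>M \<subseteq> K\<close> \<open>M \<subseteq> - W\<close> UW(4) sub by auto
  then show thesis using that VC(1,2) by blast
qed

text \<open>With \<open>y = c 0\<close>, the bounds \<open>c n\<close> obtained by iteration increase, and the union \<open>I\<close> of their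
  principal ideals meets \<open>K\<close> in a set open in \<open>K\<close>: for \<open>w \<in> K\<close> near a point
  \<open>z \<le> c n\<close>, the supremum \<open>sup w (c n)\<close> is near \<open>sup z (c n) = c n\<close>, hence below \<open>c (Suc n)\<close>.
  Any minimal point \<open>e\<close> of \<open>K\<close> below \<open>x\<close> and outside \<open>I\<close> has all points of \<open>K\<close> strictly below it
  in \<open>I\<close>, hence is extreme.\<close>

lemma sl_extreme_separates:
  fixes K :: "'a::locally_convex_semilattice_sup set"
  assumes K: "compact K" "sl_convex K" and xy: "x \<in> K" "y \<in> K" "\<not> x \<le> y"
  obtains e where "e \<in> sl_extreme K" "e \<le> x" "\<not> e \<le> y"
proof -
  let ?step = "\<lambda>c d. \<exists>V. open V \<and> c \<in> V \<and> K \<inter> V \<subseteq> {..d}"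
  have "\<exists>c. \<forall>n. (c n \<in> K \<and> \<not> x \<le> c n \<and> (n = 0 \<longrightarrow> c n = y)) \<and> ?step (c n) (c (Suc n))"
  proof (rule dependent_nat_choice)
    show "\<exists>c. c \<in> K \<and> \<not> x \<le> c \<and> ((0::nat) = 0 \<longrightarrow> c = y)"
      using xy by auto
  next
    fix c and n :: nat
    assume "c \<in> K \<and> \<not> x \<le> c \<and> (n = 0 \<longrightarrow> c = y)"
    then obtain d V where "d \<in> K" "\<not> x \<le> d" "open V" "c \<in> V" "K \<inter> V \<subseteq> {..d}"
      using upper_bound_of_nhd[OF K] by metis
    then show "\<exists>d. (d \<in> K \<and> \<not> x \<le> d \<and> (Suc n = 0 \<longrightarrow> d = y)) \<and> ?step c d"
      by auto
  qed
  then obtain c where c: "\<And>n. c n \<in> K" "\<And>n. \<not> x \<le> c n" "c 0 = y"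
      and "\<forall>n. ?step (c n) (c (Suc n))"
    by metis
  then obtain V where V: "\<And>n. open (V n)" "\<And>n. c n \<in> V n" "\<And>n. K \<inter> V n \<subseteq> {..c (Suc n)}"
    by metis
  have "c n \<le> c (Suc n)" for n
    using c(1) V(2,3) by blast
  then have mono: "m \<le> n \<Longrightarrow> c m \<le> c n" for m n
    by (rule lift_Suc_mono_le)
  define I where "I = (\<Union>n. {..c n})"
  have conv: "sl_convex I"
    unfolding sl_convex_def
  proof (intro ballI)
    fix a b assume "a \<in> I" "b \<in> I"
    then obtain m n where "a \<le> c m" "b \<le> c n" by (auto simp: I_def)
    then have "a \<le> c (max m n)" "b \<le> c (max m n)"
      using mono[of m "max m n"] mono[of n "max m n"] by (auto intro: order_trans)
    then show "sup a b \<in> I" by (auto simp: I_def)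
  qed
  define J where "J = (\<Union>n. (\<lambda>z. sup z (c n)) -` V n)"
  have "open J"
    unfolding J_def using V(1) by (auto intro!: open_UN open_vimage continuous_on_sup_left)
  have IJ: "z \<in> I \<longleftrightarrow> z \<in> J" if "z \<in> K" for z
  proof
    assume "z \<in> I"
    then obtain n where "z \<le> c n" by (auto simp: I_def)
    then have "sup z (c n) = c n" by (simp add: sup.absorb2)
    then show "z \<in> J" using V(2)[of n] by (auto simp: J_def intro!: exI[of _ n])
  next
    assume "z \<in> J"
    then obtain n where "sup z (c n) \<in> V n" by (auto simp: J_def)
    moreover have "sup z (c n) \<in> K"
      using \<open>sl_convex K\<close> that c(1) by (simp add: sl_convex_def)
    ultimately have "sup z (c n) \<le> c (Suc n)" using V(3) by blast
    then show "z \<in> I" by (auto simp: I_def)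
  qed
  have "x \<notin> I" using c(2) by (auto simp: I_def)
  let ?T = "K \<inter> ({..x} \<inter> - J)"
  have "compact ?T"
    using K(1) \<open>open J\<close> by (intro compact_Int_closed closed_Int closed_sl_atMost) auto
  moreover have "?T \<noteq> {}"
    using xy(1) IJ \<open>x \<notin> I\<close> by auto
  ultimately obtain e where e: "e \<in> ?T" "\<And>a. a \<in> ?T \<Longrightarrow> a \<le> e \<Longrightarrow> a = e"
    by (rule compact_has_minimal) blast
  have "e \<notin> I" using e(1) IJ by auto
  have "e \<in> sl_extreme K"
  proof (rule sl_extremeI[OF _ conv \<open>e \<notin> I\<close>])
    show "a \<in> I" if "a \<in> K" "a \<le> e" "a \<noteq> e" for a
      using e that IJ order_trans[of a e x] by auto
  qed (use e in auto)
  moreover have "\<not> e \<le> y"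
    using \<open>e \<notin> I\<close> c(3) by (auto simp: I_def)
  ultimately show thesis using that e(1) by auto
qed

section \<open>Points as suprema of extreme points\<close>

lemma mem_closure_sl_co_sl_extreme:
  fixes K :: "'a::locally_convex_semilattice_sup set"
  assumes K: "compact K" "sl_convex K" and "x \<in> K"
  shows "x \<in> closure (sl_co (sl_extreme K))"
proof -
  define E where "E = sl_extreme K \<inter> {..x}"
  define M where "M = closure (sl_co E)"
  have "E \<noteq> {}"
    using sl_extreme_below[OF K(1) \<open>x \<in> K\<close>] by (auto simp: E_def)
  have EM: "E \<subseteq> M"
    unfolding M_def using subset_sl_co closure_subset by (rule order_trans)
  have "sl_convex (K \<inter> {..x})"
    using K(2) by (auto simp: sl_convex_def)
  then have MK: "M \<subseteq> K \<inter> {..x}"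
    unfolding M_def
    by (intro closure_minimal sl_co_minimal closed_Int compact_imp_closed K(1) closed_sl_atMost)
       (auto simp: E_def sl_extreme_def)
  have "compact M"
    using compact_Int_closed[OF K(1), of M] MK by (simp add: M_def Int_absorb1)
  moreover have "sl_convex M"
    unfolding M_def by (intro sl_convex_closure sl_convex_sl_co)
  ultimately obtain y where y: "y \<in> M" "\<And>a. a \<in> M \<Longrightarrow> a \<le> y"
    using compact_sl_convex_has_greatest[of M] \<open>E \<noteq> {}\<close> EM by blast
  have "x \<le> y"
  proof (rule ccontr)
    assume "\<not> x \<le> y"
    then obtain e where "e \<in> sl_extreme K" "e \<le> x" "\<not> e \<le> y"
      using sl_extreme_separates[OF K \<open>x \<in> K\<close>, of y] y(1) MK by blast
    then show False using y(2) EM by (auto simp: E_def)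
  qed
  then have "x = y"
    using y(1) MK by (auto intro: antisym)
  moreover have "M \<subseteq> closure (sl_co (sl_extreme K))"
    unfolding M_def E_def sl_co_def by (intro closure_mono hull_mono) auto
  ultimately show ?thesis using y(1) by blast
qed

theorem theorem4p3:
  shows "(\<forall>A :: 'a::locally_convex_semilattice_sup set.
            compact A \<and> A \<noteq> {} \<longrightarrow> sl_extreme A \<noteq> {}) \<and>
         (\<forall>K :: 'a set.
            compact K \<and> sl_convex K \<longrightarrow> K = closure (sl_co (sl_extreme K)))"
proof (intro conjI allI impI)
  fix A :: "'a set"
  assume "compact A \<and> A \<noteq> {}"
  then show "sl_extreme A \<noteq> {}"
    using sl_extreme_below by (metis all_not_in_conv)
next
  fix K :: "'a set"
  assume K: "compact K \<and> sl_convex K"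
  show "K = closure (sl_co (sl_extreme K))"
  proof
    show "K \<subseteq> closure (sl_co (sl_extreme K))"
      using K mem_closure_sl_co_sl_extreme by blast
    show "closure (sl_co (sl_extreme K)) \<subseteq> K"
      using K by (intro closure_minimal sl_co_minimal compact_imp_closed)
        (auto simp: sl_extreme_def)
  qed
qed

end
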